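(* Let $\alpha>3$, $L>0$, $0<s<L^{-1}$ and $R>0$ be real numbers, and let $G:\{1,2,3,\dots\}\to(0,\infty)$ be a nondecreasing sequence with $G(n)\to\infty$ as $n\to\infty$. Then there is a function $F:\mathbb R\to\mathbb R$ that is even, convex, coercive and differentiable with $L$-Lipschitz derivative $F'$, whose unique minimizer is $0$ with $F(0)=0=F^*$, such that the CD orbit $(x_n)$ of $F$ with damping $\alpha$ and step $s$ started from $x_0=x_1=R$ satisfies $$\sup_{n\ge1} n^2G(n)\bigl(F(x_n)-F^*\bigr)=\infty .$$ Moreover, the construction extends to every fixed finite dimension: for every integer $d\ge1$ there is a convex, coercive, differentiable function $\widehat F:\mathbb R^d\to\mathbb R$ with $L$-Lipschitz gradient and a unique minimizer $\widehat x^*$, and an initialization $\widehat x_0=\widehat x_1\in\mathbb R^d$ with $\|\widehat x_1-\widehat x^*\|=R$, such that the CD orbit $(\widehat x_n)$ of $\widehat F$ with the same damping $\alpha$ and step $s$ from this initialization satisfies $\widehat F(\widehat x_n)-\widehat F^*=F(x_n)-F^*$ for all $n\ge1$.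
   Context: Norms and inner products on $\mathbb R^d$ are Euclidean. For a function $F:\mathbb R^d\to\mathbb R$ attaining its minimum, $F^*=\min F$. $F$ is coercive if $F(x)\to\infty$ as $\|x\|\to\infty$. The gradient is $L$-Lipschitz if $\|\nabla F(x)-\nabla F(z)\|\le L\|x-z\|$ for all $x,z\in\mathbb R^d$. CD (Chambolle--Dossal) iteration: for a differentiable $F:\mathbb R^d\to\mathbb R$, damping $\alpha$, step $s$ and initialization $x_0,x_1\in\mathbb R^d$, the CD orbit $(x_n)$ is defined by $$\beta_n=\frac{n-1}{n+\alpha-1},\qquad y_n=x_n+\beta_n(x_n-x_{n-1}),\qquad x_{n+1}=y_n-s\nabla F(y_n),\qquad n\ge1.$$ In dimension one $\nabla F=F'$. *)

theory Defs
  imports "HOL-Analysis.Analysis"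
begin

text \<open>
  The statement quantifies over the dimension \<open>d\<close> inside the scope of an existential quantifier,
  so \<open>d\<close> cannot be a type. All spaces \<open>\<real>\<^sup>d\<close> are therefore realised inside one real
  inner product space: finitely supported real sequences with the Euclidean inner product, where
  \<open>\<real>\<^sup>d\<close> is the linear subspace of sequences supported on \<open>{0..<d}\<close>. The lemma
  \<open>Rspace_isometric\<close> below identifies this subspace with the usual Euclidean spaces.
\<close>

typedef rseq = "{f :: nat \<Rightarrow> real. finite {i. f i \<noteq> 0}}"
  morphisms coord Abs_rseq
  by (rule exI [of _ "\<lambda>_. 0"]) simp

setup_lifting type_definition_rseq

lemma finite_coord: "finite {i. coord x i \<noteq> 0}"
  using coord [of x] by simp

lemma rseq_eqI: "(\<And>i. coord x i = coord y i) \<Longrightarrow> x = y"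
  by (metis coord_inject ext)

instantiation rseq :: real_vector
begin

lift_definition zero_rseq :: rseq is "\<lambda>_. 0" by simp

lift_definition plus_rseq :: "rseq \<Rightarrow> rseq \<Rightarrow> rseq" is "\<lambda>f g i. f i + g i"
proof -
  fix f g :: "nat \<Rightarrow> real"
  assume "finite {i. f i \<noteq> 0}" "finite {i. g i \<noteq> 0}"
  then show "finite {i. f i + g i \<noteq> 0}"
    by (rule_tac finite_subset [of _ "{i. f i \<noteq> 0} \<union> {i. g i \<noteq> 0}"]) auto
qed

lift_definition minus_rseq :: "rseq \<Rightarrow> rseq \<Rightarrow> rseq" is "\<lambda>f g i. f i - g i"
proof -
  fix f g :: "nat \<Rightarrow> real"
  assume "finite {i. f i \<noteq> 0}" "finite {i. g i \<noteq> 0}"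
  then show "finite {i. f i - g i \<noteq> 0}"
    by (rule_tac finite_subset [of _ "{i. f i \<noteq> 0} \<union> {i. g i \<noteq> 0}"]) auto
qed

lift_definition uminus_rseq :: "rseq \<Rightarrow> rseq" is "\<lambda>f i. - f i" by simp

lift_definition scaleR_rseq :: "real \<Rightarrow> rseq \<Rightarrow> rseq" is "\<lambda>r f i. r * f i"
  by (rule finite_subset) auto

instance
  by standard (transfer; simp add: algebra_simps fun_eq_iff)+

end

instantiation rseq :: real_inner
begin

definition inner_rseq :: "rseq \<Rightarrow> rseq \<Rightarrow> real" where
  "inner_rseq x y = (\<Sum>i | coord x i \<noteq> 0. coord x i * coord y i)"

definition norm_rseq :: "rseq \<Rightarrow> real" where
  "norm_rseq x = sqrt (inner x x)"

definition sgn_rseq :: "rseq \<Rightarrow> rseq" where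
  "sgn_rseq x = x /\<^sub>R norm x"

definition dist_rseq :: "rseq \<Rightarrow> rseq \<Rightarrow> real" where
  "dist_rseq x y = norm (x - y)"

definition uniformity_rseq :: "(rseq \<times> rseq) filter" where
  "uniformity_rseq = (INF e\<in>{0<..}. principal {(x, y). dist x y < e})"

definition open_rseq :: "rseq set \<Rightarrow> bool" where
  "open_rseq U = (\<forall>x\<in>U. eventually (\<lambda>(x', y). x' = x \<longrightarrow> y \<in> U) uniformity)"

instance
proof
  have ex: "inner x y = (\<Sum>i\<in>A. coord x i * coord y i)"
    if "finite A" "{i. coord x i \<noteq> 0} \<subseteq> A" for A and x y :: rseq
    unfolding inner_rseq_def by (rule sum.mono_neutral_left) (use that in auto)
  fix x y z :: rseq and a :: real
  show "sgn x = x /\<^sub>R norm x" "dist x y = norm (x - y)" "norm x = sqrt (inner x x)"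
    by (simp_all add: sgn_rseq_def dist_rseq_def norm_rseq_def)
  show "uniformity = (INF e\<in>{0<..}. principal {(x :: rseq, y). dist x y < e})"
    by (rule uniformity_rseq_def)
  show "open U = (\<forall>x\<in>U. \<forall>\<^sub>F (x', y) in uniformity. x' = x \<longrightarrow> y \<in> U)" for U :: "rseq set"
    by (rule open_rseq_def)
  define A where "A = {i. coord x i \<noteq> 0} \<union> {i. coord y i \<noteq> 0}"
  have A: "finite A" "{i. coord x i \<noteq> 0} \<subseteq> A" "{i. coord y i \<noteq> 0} \<subseteq> A"
    by (auto simp: A_def finite_coord)
  show "inner x y = inner y x"
    by (simp add: ex [OF A(1,2)] ex [OF A(1,3)] mult.commute)
  have "{i. coord (x + y) i \<noteq> 0} \<subseteq> A"
    by (auto simp: A_def plus_rseq.rep_eq)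
  then show "inner (x + y) z = inner x z + inner y z"
    by (simp add: ex [OF A(1)] A(2,3) plus_rseq.rep_eq sum.distrib distrib_right)
  have "{i. coord (a *\<^sub>R x) i \<noteq> 0} \<subseteq> A"
    by (auto simp: A_def scaleR_rseq.rep_eq)
  then show "inner (a *\<^sub>R x) y = a * inner x y"
    by (simp add: ex [OF A(1)] A(2) scaleR_rseq.rep_eq sum_distrib_left mult.assoc)
  show "0 \<le> inner x x"
    by (simp add: inner_rseq_def sum_nonneg)
  show "inner x x = 0 \<longleftrightarrow> x = 0"
  proof
    assume "inner x x = 0"
    then have "\<forall>i\<in>{i. coord x i \<noteq> 0}. coord x i * coord x i = 0"
      unfolding inner_rseq_def by (subst (asm) sum_nonneg_eq_0_iff) (auto simp: finite_coord)
    then show "x = 0"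
      by (intro rseq_eqI) (auto simp: zero_rseq.rep_eq)
  qed (simp add: inner_rseq_def zero_rseq.rep_eq)
qed

end

definition Rspace :: "nat \<Rightarrow> rseq set" where
  "Rspace d = {x. \<forall>i\<ge>d. coord x i = 0}"

lemma inner_Rspace:
  assumes "x \<in> Rspace d"
  shows "inner x y = (\<Sum>i<d. coord x i * coord y i)"
  unfolding inner_rseq_def
proof (rule sum.mono_neutral_left)
  show "{i. coord x i \<noteq> 0} \<subseteq> {..<d}"
    using assms by (force simp: Rspace_def not_less [symmetric])
qed auto

lemma subspace_Rspace: "subspace (Rspace d)"
  by (auto simp: subspace_def Rspace_def plus_rseq.rep_eq scaleR_rseq.rep_eq zero_rseq.rep_eq)

lemma Rspace_isometric:
  "\<exists>\<phi> :: 'a::euclidean_space \<Rightarrow> rseq.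
     linear \<phi> \<and> (\<forall>x y. inner (\<phi> x) (\<phi> y) = inner x y) \<and> range \<phi> = Rspace DIM('a)"
proof -
  obtain b where b: "bij_betw b {..<DIM('a)} (Basis :: 'a set)"
    using ex_bij_betw_nat_finite [OF finite_Basis] by (auto simp: atLeast0LessThan)
  define \<phi> :: "'a \<Rightarrow> rseq"
    where "\<phi> x = Abs_rseq (\<lambda>i. if i < DIM('a) then inner x (b i) else 0)" for x
  have coord_\<phi>: "coord (\<phi> x) i = (if i < DIM('a) then inner x (b i) else 0)" for x i
    unfolding \<phi>_def by (subst Abs_rseq_inverse) (auto intro: finite_subset [of _ "{..<DIM('a)}"])
  have mem: "\<phi> x \<in> Rspace DIM('a)" for x
    by (simp add: Rspace_def coord_\<phi>)
  have "linear \<phi>"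
    by (rule linearI; rule rseq_eqI)
      (simp_all add: coord_\<phi> plus_rseq.rep_eq scaleR_rseq.rep_eq inner_add_left)
  moreover have "inner (\<phi> x) (\<phi> y) = inner x y" for x y
  proof -
    have "inner (\<phi> x) (\<phi> y) = (\<Sum>i<DIM('a). inner x (b i) * inner y (b i))"
      by (simp add: inner_Rspace [OF mem] coord_\<phi>)
    also have "\<dots> = (\<Sum>u\<in>Basis. inner x u * inner y u)"
      by (rule sum.reindex_bij_betw [OF b])
    finally show ?thesis
      by (simp add: euclidean_inner [symmetric])
  qed
  moreover have "z \<in> range \<phi>" if z: "z \<in> Rspace DIM('a)" for z
  proof
    define x where "x = (\<Sum>j<DIM('a). coord z j *\<^sub>R b j)"
    show "z = \<phi> x"
    proof (rule rseq_eqI)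
      fix i
      have "inner x (b i) = coord z i" if i: "i < DIM('a)"
      proof -
        have "inner (b j) (b i) = (if j = i then 1 else 0)" if "j < DIM('a)" for j
        proof -
          have "b j \<in> Basis" "b i \<in> Basis" "b j = b i \<longleftrightarrow> j = i"
            using that i b by (auto simp: bij_betw_def inj_on_def)
          then show ?thesis
            by (simp add: inner_Basis)
        qed
        then have "inner x (b i) = (\<Sum>j<DIM('a). coord z j * (if j = i then 1 else 0))"
          by (simp add: x_def inner_sum_left)
        then show ?thesis
          using i by (simp add: if_distrib cong: if_cong)
      qed
      then show "coord z i = coord (\<phi> x) i"
        using z by (simp add: coord_\<phi> Rspace_def)
    qed
  qed simp
  ultimately show ?thesis
    using mem by blast
qed

text \<open>
  In the following definitions \<open>S\<close> is a linear subspace, regarded as a Euclidean space of its own.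
\<close>

definition coercive_on :: "'a::real_normed_vector set \<Rightarrow> ('a \<Rightarrow> real) \<Rightarrow> bool" where
  "coercive_on S F \<longleftrightarrow> filterlim F at_top (inf at_infinity (principal S))"

definition has_gradient_on :: "('a::real_inner \<Rightarrow> real) \<Rightarrow> ('a \<Rightarrow> 'a) \<Rightarrow> 'a set \<Rightarrow> bool" where
  "has_gradient_on F g S \<longleftrightarrow>
     (\<forall>x\<in>S. g x \<in> S \<and> (F has_derivative (\<lambda>h. inner h (g x))) (at x within S))"

lemma has_gradient_on_UNIV: "has_gradient_on F g UNIV \<longleftrightarrow> (\<forall>x. GDERIV F x :> g x)"
  by (simp add: has_gradient_on_def gderiv_def)

lemma has_gradient_on_unique:
  assumes S: "subspace S" and g: "has_gradient_on F g S" "has_gradient_on F g' S" and x: "x \<in> S"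
  shows "g x = g' x"
proof -
  define h where "h = g x - g' x"
  have h: "h \<in> S"
    using g x S by (auto simp: h_def has_gradient_on_def subspace_diff)
  have line: "((\<lambda>t. x + t *\<^sub>R h) has_derivative (\<lambda>t. t *\<^sub>R h)) (at 0)"
    by (auto intro!: derivative_eq_intros)
  have img: "range (\<lambda>t. x + t *\<^sub>R h) \<subseteq> S"
    using S x h by (auto intro: subspace_add subspace_scale)
  have D: "((\<lambda>t. F (x + t *\<^sub>R h)) has_derivative (\<lambda>t. inner (t *\<^sub>R h) (G x))) (at 0)"
    if "has_gradient_on F G S" for G
  proof -
    have "(F has_derivative (\<lambda>h. inner h (G x))) (at (x + 0 *\<^sub>R h) within range (\<lambda>t. x + t *\<^sub>R h))"
      using that x img by (auto simp: has_gradient_on_def intro: has_derivative_subset)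
    from has_derivative_in_compose [OF line this] show ?thesis by simp
  qed
  have "(\<lambda>t. inner (t *\<^sub>R h) (g x)) = (\<lambda>t. inner (t *\<^sub>R h) (g' x))"
    by (rule has_derivative_unique [OF D [OF g(1)] D [OF g(2)]])
  from fun_cong [OF this, of 1] have "inner h h = 0"
    by (simp add: h_def inner_diff_right)
  then show ?thesis
    by (simp add: h_def)
qed

definition unique_minimizer_on :: "'a set \<Rightarrow> ('a \<Rightarrow> real) \<Rightarrow> 'a \<Rightarrow> bool" where
  "unique_minimizer_on S F z \<longleftrightarrow> (\<forall>x. is_arg_min F (\<lambda>y. y \<in> S) x \<longleftrightarrow> x = z)"

definition min_value_on :: "'a set \<Rightarrow> ('a \<Rightarrow> real) \<Rightarrow> real" where
  "min_value_on S F = (LEAST m. m \<in> F ` S)"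

text \<open>
  The recursion \<open>x\<^bsub>N+1\<^esub> = y\<^bsub>N\<^esub> - s \<nabla>F(y\<^bsub>N\<^esub>)\<close> for \<open>N \<ge> 1\<close>, with \<open>N = Suc n\<close> and
  \<open>g = \<nabla>F\<close>. The denominator \<open>N + \<alpha> - 1\<close> of \<open>\<beta>\<^bsub>N\<^esub>\<close> is positive when \<open>\<alpha> > 0\<close>.
\<close>

fun cd_orbit :: "real \<Rightarrow> real \<Rightarrow> ('a::real_vector \<Rightarrow> 'a) \<Rightarrow> 'a \<Rightarrow> 'a \<Rightarrow> nat \<Rightarrow> 'a" where
  "cd_orbit \<alpha> s g x0 x1 0 = x0"
| "cd_orbit \<alpha> s g x0 x1 (Suc 0) = x1"
| "cd_orbit \<alpha> s g x0 x1 (Suc (Suc n)) =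
     (let N = real (Suc n);
          \<beta> = (N - 1) / (N + \<alpha> - 1);
          y = cd_orbit \<alpha> s g x0 x1 (Suc n)
              + \<beta> *\<^sub>R (cd_orbit \<alpha> s g x0 x1 (Suc n) - cd_orbit \<alpha> s g x0 x1 n)
      in y - s *\<^sub>R g y)"

end

theory Submission
  imports Defs
begin

text \<open>
  The proof designs the orbit first and recovers the function from it. Along a one-dimensional
  orbit, put \<open>d\<^sub>n = x\<^sub>n - x\<^bsub>n+1\<^esub>\<close> and \<open>p\<^sub>n = s F'(y\<^sub>n)\<close>. The iteration then reads
  \<open>d\<^sub>n = \<beta>\<^sub>n d\<^bsub>n-1\<^esub> + p\<^sub>n\<close>, so any sequence of impulses \<open>p\<^sub>n\<close> determines the trajectory, and a
  function \<open>F\<close> produces it as soon as \<open>F'\<close> takes the value \<open>p\<^sub>n / s\<close> at \<open>y\<^sub>n\<close> for all \<open>n\<close>. The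
  points \<open>y\<^sub>n\<close> satisfy \<open>y\<^sub>n - y\<^bsub>n+1\<^esub> \<ge> p\<^sub>n\<close>. Hence, if the impulses are positive and decreasing with
  \<open>p\<^sub>n - p\<^bsub>n+1\<^esub> \<le> s L p\<^sub>n\<close>, the prescribed values of \<open>F'\<close> are nondecreasing in \<open>y\<close> with
  slopes at most \<open>L\<close>, and they extend to an odd, nondecreasing, \<open>L\<close>-Lipschitz function on the line
  (\<open>monotone_lipschitz_interpolation\<close>) whose antiderivative is \<open>F\<close>
  (\<open>even_convex_potential\<close>).

  An impulse \<open>p\<^sub>n\<close> eventually moves the orbit by \<open>p\<^sub>n (n + \<alpha> - 1) / (\<alpha> - 1)\<close>, since the later
  momentum steps amplify it by that factor. If these total displacements add up to \<open>R\<close>,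
  the orbit decreases to \<open>0\<close> without ever crossing it (\<open>position_tendsto_0\<close>), so no analysis
  of oscillations is needed. Apart from positivity, monotonicity and the slope condition, the
  impulses are therefore only constrained by \<open>\<Sum> n p\<^sub>n < \<infinity>\<close>.

  For the size of \<open>F\<close>: the gaps satisfy \<open>d\<^sub>n \<ge> n p\<^bsub>n+1\<^esub> / (\<alpha> + 1)\<close>, so between the times \<open>n\<close>
  and \<open>2 n\<close>, up to index shifts, the orbit moves by at least \<open>n\<^sup>2 p\<^bsub>2n\<^esub> / (\<alpha> + 1)\<close>, against a slope of at least about
  \<open>p\<^bsub>2n\<^esub> / s\<close>. By convexity \<open>n\<^sup>2 F(x\<^sub>n)\<close> is at least of the order of \<open>(n\<^sup>2 p\<^bsub>2n\<^esub>)\<^sup>2\<close>. Summability of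
  \<open>n p\<^sub>n\<close> permits \<open>N\<^sup>2 p\<^bsub>2N\<^esub>\<close> to be of order \<open>2\<^sup>-\<^sup>k\<close> along a sequence \<open>N = N\<^sub>k\<close> that grows as fast as
  desired, for example so fast that \<open>G(N\<^sub>k) \<ge> 8\<^sup>k\<close>; this is \<open>exists_slow_impulses\<close>.

  In higher dimension, \<open>F\<close> is used along one axis and a quadratic of curvature \<open>L\<close> across it. On
  the axis the gradient is parallel to the axis, so an orbit started there never leaves it.
\<close>

section \<open>A trajectory prescribed by its impulses\<close>

text \<open>
  Time is shifted by one against the iteration: the value at \<open>n\<close> of the impulses \<open>q\<close> and of
  \<open>extrapolated\<close> belongs to \<open>y\<^bsub>n+1\<^esub>\<close>, where \<open>\<beta>\<^bsub>n+1\<^esub> = n / (n + \<alpha>)\<close>. The first gap is \<open>0\<close>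
  because \<open>x\<^sub>0 = x\<^sub>1\<close>.
\<close>
primrec gap :: "real \<Rightarrow> (nat \<Rightarrow> real) \<Rightarrow> nat \<Rightarrow> real" where
  "gap \<alpha> q 0 = 0"
| "gap \<alpha> q (Suc n) = real n / (real n + \<alpha>) * gap \<alpha> q n + q n"

definition position :: "real \<Rightarrow> real \<Rightarrow> (nat \<Rightarrow> real) \<Rightarrow> nat \<Rightarrow> real" where
  "position \<alpha> R q n = R - (\<Sum>i<n. gap \<alpha> q i)"

definition extrapolated :: "real \<Rightarrow> real \<Rightarrow> (nat \<Rightarrow> real) \<Rightarrow> nat \<Rightarrow> real" where
  "extrapolated \<alpha> R q n = position \<alpha> R q (Suc n) - real n / (real n + \<alpha>) * gap \<alpha> q n"

lemma position_Suc: "position \<alpha> R q (Suc n) = position \<alpha> R q n - gap \<alpha> q n"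
  by (simp add: position_def)

lemma position_Suc_Suc: "position \<alpha> R q (Suc (Suc n)) = extrapolated \<alpha> R q n - q n"
  by (simp add: position_def extrapolated_def)

text \<open>
  This turns the design problem into an interpolation problem for the derivative \<open>h\<close>.
\<close>
lemma cd_orbit_eq_position:
  assumes "\<And>n. s * h (extrapolated \<alpha> R q n) = q n"
  shows "cd_orbit \<alpha> s h R R n = position \<alpha> R q n"
proof (induction n rule: induct_nat_012)
  case (ge2 n)
  have "position \<alpha> R q (Suc n) + real n / (real n + \<alpha>) * (position \<alpha> R q (Suc n) - position \<alpha> R q n)
      = extrapolated \<alpha> R q n"
    by (simp add: extrapolated_def position_Suc algebra_simps)
  then show ?case
    using ge2 assms[of n] by (simp add: position_Suc_Suc Let_def)
qed (simp_all add: position_def)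

text \<open>
  The weight \<open>(n + \<alpha>) / (\<alpha> - 1)\<close> is the sum of all products \<open>\<beta>\<^bsub>n+2\<^esub> \<dots> \<beta>\<^sub>m\<close> with \<open>m \<ge> n + 1\<close> (the
  empty product included), that is, the displacement that a unit impulse causes in the long
  run. The budget says that the impulses transport the orbit from \<open>R\<close> exactly to \<open>0\<close>.
\<close>
locale impulses =
  fixes \<alpha> R :: real and q :: "nat \<Rightarrow> real"
  assumes alpha: "\<alpha> > 1"
    and q_pos: "\<And>n. q n > 0"
    and q_dec: "decseq q"
    and budget: "(\<lambda>n. (real n + \<alpha>) / (\<alpha> - 1) * q n) sums R"
begin

lemma gap_nonneg: "gap \<alpha> q n \<ge> 0"
proof (induction n)
  case (Suc n)
  then show ?case using q_pos[of n] alpha by (simp add: add_nonneg_nonneg less_imp_le)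
qed simp

text \<open>
  With slowly varying impulses the recursion for the gaps settles near \<open>n q\<^sub>n / (\<alpha> + 1)\<close>. Decreasing
  impulses can only leave the gaps above this value, which is all that the lower bound needs.
\<close>
lemma linear_le_gap: "real n * q n / (\<alpha> + 1) \<le> gap \<alpha> q n"
proof (induction n)
  case (Suc n)
  define m where "m = real n"
  have m: "m \<ge> 0" by (simp add: m_def)
  have "(m + 1) * q (Suc n) / (\<alpha> + 1) \<le> (m + 1) * q n / (\<alpha> + 1)"
    using q_dec m alpha by (intro divide_right_mono mult_left_mono) (auto simp: decseq_Suc_iff)
  also have "(m + 1) / (\<alpha> + 1) \<le> m / (m + \<alpha>) * (m / (\<alpha> + 1)) + 1"
  proof -
    have "(m + 1) * (m + \<alpha>) \<le> m * m + (m + \<alpha>) * (\<alpha> + 1)"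
      using m alpha by (simp add: algebra_simps)
    then have "(m + 1) * (m + \<alpha>) / ((m + \<alpha>) * (\<alpha> + 1))
        \<le> (m * m + (m + \<alpha>) * (\<alpha> + 1)) / ((m + \<alpha>) * (\<alpha> + 1))"
      using m alpha by (intro divide_right_mono) auto
    then show ?thesis
      using m alpha by (simp add: add_divide_distrib)
  qed
  then have "(m + 1) * q n / (\<alpha> + 1) \<le> (m / (m + \<alpha>) * (m / (\<alpha> + 1)) + 1) * q n"
    using mult_right_mono[OF _ less_imp_le[OF q_pos[of n]]] by fastforce
  also have "\<dots> = m / (m + \<alpha>) * (m * q n / (\<alpha> + 1)) + q n"
    by (simp add: algebra_simps)
  also have "\<dots> \<le> m / (m + \<alpha>) * gap \<alpha> q n + q n"
    using Suc m alpha by (intro add_right_mono mult_left_mono) (auto simp: m_def)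
  finally show ?case by (simp add: m_def add.commute)
qed simp

lemma position_decseq: "decseq (position \<alpha> R q)"
  using gap_nonneg by (simp add: decseq_Suc_iff position_Suc)

text \<open>
  The left-hand side is the point where the orbit would come to rest if all later impulses were
  absent. Momentum steps do not move it, and an impulse moves it by its weight. It is the auxiliary
  sequence that appears in Lyapunov functions for accelerated gradient methods.
\<close>
lemma focus_eq_tail:
  "position \<alpha> R q (Suc n) - real n / (\<alpha> - 1) * gap \<alpha> q n
     = R - (\<Sum>i<n. (real i + \<alpha>) / (\<alpha> - 1) * q i)"
proof (induction n)
  case (Suc n)
  define D p where "D = gap \<alpha> q n" and "p = q n"
  have nz: "real n + \<alpha> \<noteq> 0" "\<alpha> - 1 \<noteq> 0" using alpha by auto
  have "1 + real (Suc n) / (\<alpha> - 1) = (real n + \<alpha>) / (\<alpha> - 1)"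
    using nz by (simp add: field_simps)
  moreover have "position \<alpha> R q (Suc (Suc n)) - real (Suc n) / (\<alpha> - 1) * gap \<alpha> q (Suc n)
      = position \<alpha> R q (Suc n) - (1 + real (Suc n) / (\<alpha> - 1)) * gap \<alpha> q (Suc n)"
    by (simp add: position_Suc[of _ _ _ "Suc n"] distrib_right del: gap.simps of_nat_Suc)
  ultimately have "position \<alpha> R q (Suc (Suc n)) - real (Suc n) / (\<alpha> - 1) * gap \<alpha> q (Suc n)
      = position \<alpha> R q (Suc n) - (real n + \<alpha>) / (\<alpha> - 1) * (real n / (real n + \<alpha>) * D + p)"
    by (simp add: D_def p_def)
  also have "(real n + \<alpha>) / (\<alpha> - 1) * (real n / (real n + \<alpha>) * D + p)
      = real n / (\<alpha> - 1) * D + (real n + \<alpha>) / (\<alpha> - 1) * p"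
  proof -
    have "c / b * (a / c * D + p) = a / b * D + c / b * p" if "c \<noteq> 0" for a b c :: real
      using that by (simp add: distrib_left)
    then show ?thesis using nz by blast
  qed
  finally show ?case using Suc by (simp add: D_def p_def)
qed (simp add: position_def)

lemma focus_pos: "0 < position \<alpha> R q (Suc n) - real n / (\<alpha> - 1) * gap \<alpha> q n"
proof -
  have "(\<Sum>i<n. (real i + \<alpha>) / (\<alpha> - 1) * q i) < (\<Sum>i. (real i + \<alpha>) / (\<alpha> - 1) * q i)"
    using budget alpha q_pos
    by (intro sum_less_suminf) (auto intro!: mult_pos_pos divide_pos_pos add_nonneg_pos simp: sums_iff)
  then show ?thesis
    using focus_eq_tail[of n] sums_unique[OF budget] by linarith
qed

lemma focus_tendsto_0:
  "(\<lambda>n. position \<alpha> R q (Suc n) - real n / (\<alpha> - 1) * gap \<alpha> q n) \<longlonglongrightarrow> 0"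
  unfolding focus_eq_tail
  using tendsto_diff[OF tendsto_const budget[unfolded sums_def], of R] by simp

lemma extrapolated_pos: "0 < extrapolated \<alpha> R q n"
proof -
  have "real n / (real n + \<alpha>) \<le> real n / (\<alpha> - 1)"
    using alpha by (intro divide_left_mono) auto
  then have "real n / (real n + \<alpha>) * gap \<alpha> q n \<le> real n / (\<alpha> - 1) * gap \<alpha> q n"
    using gap_nonneg by (rule mult_right_mono)
  then show ?thesis
    using focus_pos[of n] by (simp add: extrapolated_def)
qed

lemma extrapolated_le_position: "extrapolated \<alpha> R q n \<le> position \<alpha> R q (Suc n)"
  using gap_nonneg[of n] alpha by (simp add: extrapolated_def)

lemma extrapolated_step: "q n \<le> extrapolated \<alpha> R q n - extrapolated \<alpha> R q (Suc n)"
proof -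
  have "0 \<le> real (Suc n) / (real (Suc n) + \<alpha>) * gap \<alpha> q (Suc n)"
    using gap_nonneg[of "Suc n"] alpha by (intro mult_nonneg_nonneg) (auto simp del: gap.simps)
  then show ?thesis
    using position_Suc_Suc[of \<alpha> R q n] unfolding extrapolated_def[of \<alpha> R q "Suc n"] by linarith
qed

lemma extrapolated_decseq: "decseq (extrapolated \<alpha> R q)"
  unfolding decseq_Suc_iff
proof
  show "extrapolated \<alpha> R q (Suc n) \<le> extrapolated \<alpha> R q n" for n
    using extrapolated_step[of n] q_pos[of n] by linarith
qed

text \<open>
  The rest point tends to \<open>0\<close>. If the decreasing orbit stayed above some \<open>l > 0\<close>, its distance
  \<open>n / (\<alpha> - 1) d\<^sub>n\<close> from the rest point would eventually exceed \<open>l / 2\<close>, so the gaps would dominate a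
  multiple of the harmonic series, although they sum to at most \<open>R\<close>.
\<close>
lemma position_tendsto_0: "position \<alpha> R q \<longlonglongrightarrow> 0"
proof -
  have pos: "position \<alpha> R q n \<ge> 0" for n
    using order.trans[OF extrapolated_le_position position_decseq[THEN decseqD, of n "Suc n"]]
      extrapolated_pos[of n] by fastforce
  have "Bseq (position \<alpha> R q)"
    by (rule decseq_bounded[OF position_decseq, of 0]) (use pos in auto)
  then obtain l where l: "position \<alpha> R q \<longlonglongrightarrow> l"
    using Bseq_monoseq_convergent position_decseq decseq_imp_monoseq convergent_def by metis
  have l_le: "l \<le> position \<alpha> R q n" for n
    by (rule decseq_ge[OF position_decseq l])
  have "l \<ge> 0" by (rule LIMSEQ_le_const[OF l]) (use pos in auto)
  moreover have False if "l > 0"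
  proof -
    have "\<forall>\<^sub>F n in sequentially. position \<alpha> R q (Suc n) - real n / (\<alpha> - 1) * gap \<alpha> q n < l / 2"
      using focus_tendsto_0 that by (intro order_tendstoD) auto
    then have ev: "\<forall>\<^sub>F n in sequentially. norm (inverse (real n)) \<le> 2 / (l * (\<alpha> - 1)) * gap \<alpha> q n"
      using eventually_gt_at_top[of 0]
    proof eventually_elim
      case (elim n)
      have "l / 2 \<le> real n / (\<alpha> - 1) * gap \<alpha> q n"
        using elim l_le[of "Suc n"] by linarith
      then show ?case
        using elim that alpha by (simp add: field_simps)
    qed
    have "(\<lambda>n. \<Sum>i<n. gap \<alpha> q i) \<longlonglongrightarrow> R - l"
      using tendsto_diff[OF tendsto_const l, of R] by (simp add: position_def)
    then have "summable (gap \<alpha> q)"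
      by (auto simp: summable_def sums_def)
    then have "summable (\<lambda>n. inverse (real n))"
      by (intro summable_comparison_test_ev[OF ev] summable_mult)
    then show False
      using not_summable_harmonic[where 'a = real] by simp
  qed
  ultimately show ?thesis using l by (metis not_less order.antisym linorder_not_le)
qed

lemma extrapolated_tendsto_0: "extrapolated \<alpha> R q \<longlonglongrightarrow> 0"
  by (rule tendsto_sandwich[OF _ _ tendsto_const LIMSEQ_Suc[OF position_tendsto_0]])
     (auto simp: extrapolated_le_position extrapolated_pos less_imp_le)

lemma q_tendsto_0: "q \<longlonglongrightarrow> 0"
proof (rule tendsto_sandwich[OF _ _ tendsto_const])
  show "(\<lambda>n. extrapolated \<alpha> R q n) \<longlonglongrightarrow> 0" by (rule extrapolated_tendsto_0)
  have "q n \<le> extrapolated \<alpha> R q n" for n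
    using extrapolated_step[of n] extrapolated_pos[of "Suc n"] by linarith
  then show "\<forall>\<^sub>F n in sequentially. q n \<le> extrapolated \<alpha> R q n" by simp
qed (auto simp: q_pos less_imp_le)

lemma position_drop:
  "(real n)\<^sup>2 * q (2 * n) / (\<alpha> + 1) \<le> position \<alpha> R q n - position \<alpha> R q (2 * n)"
proof -
  have "real n * (real n * q (2 * n) / (\<alpha> + 1)) \<le> (\<Sum>i\<in>{n..<2*n}. gap \<alpha> q i)"
  proof -
    have "real n * q (2 * n) / (\<alpha> + 1) \<le> gap \<alpha> q i" if "i \<in> {n..<2*n}" for i
    proof -
      have "real n * q (2 * n) / (\<alpha> + 1) \<le> real i * q i / (\<alpha> + 1)"
        using that alpha q_pos[of i] q_pos[of "2*n"] q_dec
        by (intro divide_right_mono mult_mono) (auto simp: less_imp_le decseqD)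
      then show ?thesis using linear_le_gap[of i] by linarith
    qed
    from sum_mono[of "{n..<2*n}", OF this] show ?thesis by simp
  qed
  also have "(\<Sum>i\<in>{n..<2*n}. gap \<alpha> q i) = position \<alpha> R q n - position \<alpha> R q (2 * n)"
    by (simp add: position_def sum_diff_nat_ivl[of 0 n "2*n", symmetric] atLeast0LessThan[symmetric])
  finally show ?thesis by (simp add: power2_eq_square)
qed

end

section \<open>Impulses that decay slowly along a subsequence\<close>

text \<open>
  The profile \<open>j \<mapsto> a / (a + j)\<^sup>3\<close> is of order \<open>a\<^sup>-\<^sup>2\<close> up to \<open>j = 2 a\<close>, has first moment bounded
  independently of \<open>a\<close> (its product with \<open>a + j\<close> is \<open>a / (a + j)\<^sup>2\<close>), and its relative decrease per step is at most about \<open>3 / a\<close>. The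
  next two lemmas are the last two of these properties.
\<close>
lemma cubic_profile_step:
  fixes a \<sigma> :: real
  assumes "a \<ge> 1" "\<sigma> > 0" "a \<ge> 3 / \<sigma>" "m \<ge> a"
  shows "a / m ^ 3 - a / (m + 1) ^ 3 \<le> \<sigma> * (a / m ^ 3)"
proof -
  have m: "m \<ge> 1" "m > 0" using assms by auto
  have "1 + real 3 * (- (1 / (m + 1))) \<le> (1 + (- (1 / (m + 1)))) ^ 3"
    using m by (intro Bernoulli_inequality) (simp add: field_simps)
  also have "1 + (- (1 / (m + 1))) = m / (m + 1)"
    using m by (simp add: field_simps)
  finally have *: "1 - 3 / (m + 1) \<le> m ^ 3 / (m + 1) ^ 3"
    by (simp add: power_divide)
  have "3 \<le> \<sigma> * (m + 1)"
  proof -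
    have "3 / \<sigma> \<le> m + 1" using assms by linarith
    then show ?thesis using assms by (simp add: field_simps)
  qed
  then have "3 / (m + 1) \<le> \<sigma>"
    using m by (simp add: field_simps)
  with * have "1 - m ^ 3 / (m + 1) ^ 3 \<le> \<sigma>" by linarith
  then have "a / m ^ 3 * (1 - m ^ 3 / (m + 1) ^ 3) \<le> a / m ^ 3 * \<sigma>"
    using assms m by (intro mult_left_mono) auto
  also have "a / m ^ 3 * (1 - m ^ 3 / (m + 1) ^ 3) = a / m ^ 3 - a / (m + 1) ^ 3"
    using m by (simp add: right_diff_distrib)
  finally show ?thesis by (simp add: mult.commute)
qed

lemma sum_inverse_squares_from:
  fixes a :: real
  assumes "a \<ge> 1"
  shows "(\<Sum>j<J. a / (a + real j)\<^sup>2) \<le> 2"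
proof -
  have "(\<Sum>j<J. a / (a + real j)\<^sup>2) \<le> 2 * (1 - a / (a + real J))"
  proof (induction J)
    case (Suc J)
    define m where "m = a + real J"
    have m: "m \<ge> 1" using assms by (simp add: m_def)
    have "a / m\<^sup>2 \<le> 2 * (a / (m * (m + 1)))"
    proof -
      have "m * (m + 1) \<le> 2 * m\<^sup>2" using m by (simp add: power2_eq_square algebra_simps)
      then have "a / m\<^sup>2 \<le> a / (m * (m + 1) / 2)"
        using m assms by (intro divide_left_mono) (auto intro!: mult_pos_pos)
      then show ?thesis by (simp add: mult.commute)
    qed
    also have "a / (m * (m + 1)) = a / m - a / (m + 1)"
      using m by (simp add: field_simps)
    finally show ?case using Suc by (simp add: m_def algebra_simps)
  qed (use assms in simp)
  also have "\<dots> \<le> 2" using assms by simp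
  finally show ?thesis .
qed

text \<open>
  The impulses are a multiple of the superposition of the cubic profiles at scales \<open>N\<^sub>k\<close> with
  weights \<open>2\<^sup>-\<^sup>k\<close>. The bound on relative decrease is linear in the profile and hence survives
  superposition, the weights keep the first moment finite, and the multiple is fixed by the
  budget.
\<close>
lemma exists_slow_impulses:
  fixes \<alpha> \<sigma> R :: real and G :: "nat \<Rightarrow> real"
  assumes \<alpha>: "\<alpha> > 1" and \<sigma>: "\<sigma> > 0" and R: "R > 0" and G: "filterlim G at_top sequentially"
  obtains q where "impulses \<alpha> R q"
    and "\<And>n. q n - q (Suc n) \<le> \<sigma> * q n"
    and "\<And>C. \<exists>n\<ge>1. C \<le> G n * ((real n)\<^sup>2 * q (2 * n))\<^sup>2"
proof -
  have "\<exists>n. n \<ge> 1 \<and> real n \<ge> 3 / \<sigma> \<and> G n \<ge> 8 ^ k" for k :: nat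
  proof -
    have "\<forall>\<^sub>F n in sequentially. n \<ge> 1 \<and> real n \<ge> 3 / \<sigma> \<and> G n \<ge> 8 ^ k"
      using eventually_ge_at_top[of 1]
        filterlim_real_sequentially[THEN filterlim_at_top[THEN iffD1, rule_format], of "3 / \<sigma>"]
        G[THEN filterlim_at_top[THEN iffD1, rule_format], of "8 ^ k"]
      by eventually_elim auto
    then show ?thesis by (auto dest: eventually_happens)
  qed
  then obtain N where N: "\<And>k. N k \<ge> 1" "\<And>k. real (N k) \<ge> 3 / \<sigma>" "\<And>k. G (N k) \<ge> 8 ^ k"
    by metis
  define \<phi> where "\<phi> k j = (1/2) ^ k * (real (N k) / (real (N k) + real j) ^ 3)" for k j
  define q0 where "q0 j = (\<Sum>k. \<phi> k j)" for j
  define w where "w j = (real j + \<alpha>) / (\<alpha> - 1)" for j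
  have N1: "real (N k) \<ge> 1" for k using N(1)[of k] by simp
  have \<phi>_pos: "\<phi> k j > 0" for k j
    using N1[of k] by (auto simp: \<phi>_def intro!: mult_pos_pos divide_pos_pos)
  have geom: "summable (\<lambda>k. (1/2 :: real) ^ k)" by (rule summable_geometric) simp
  have \<phi>_le: "\<phi> k j \<le> (1/2) ^ k" for k j
  proof -
    have "real (N k) \<le> (real (N k) + real j) ^ 1" by simp
    also have "\<dots> \<le> (real (N k) + real j) ^ 3"
      using N1[of k] by (intro power_increasing) auto
    finally have "real (N k) / (real (N k) + real j) ^ 3 \<le> 1"
      using N1[of k] by (subst divide_le_eq_1_pos) auto
    from mult_left_mono[OF this, of "(1/2) ^ k"] show ?thesis
      by (simp add: \<phi>_def)
  qed
  have \<phi>_summable: "summable (\<lambda>k. \<phi> k j)" for j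
    by (rule summable_comparison_test'[OF geom, of 0]) (use \<phi>_le \<phi>_pos in \<open>auto simp: less_imp_le\<close>)
  have q0_pos: "q0 j > 0" for j
    unfolding q0_def by (rule suminf_pos[OF \<phi>_summable \<phi>_pos])
  have \<phi>_dec: "\<phi> k (Suc j) \<le> \<phi> k j" for k j
    unfolding \<phi>_def using N1[of k]
    by (intro mult_left_mono divide_left_mono power_mono mult_pos_pos zero_less_power) auto
  have \<phi>_step: "\<phi> k j - \<phi> k (Suc j) \<le> \<sigma> * \<phi> k j" for k j
  proof -
    have "real (N k) / (real (N k) + real j) ^ 3 - real (N k) / (real (N k) + real j + 1) ^ 3
        \<le> \<sigma> * (real (N k) / (real (N k) + real j) ^ 3)"
      by (rule cubic_profile_step) (use N1[of k] N(2)[of k] \<sigma> in auto)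
    from mult_left_mono[OF this, of "(1/2)^k"] show ?thesis
      by (simp add: \<phi>_def algebra_simps)
  qed
  have q0_dec: "decseq q0"
    unfolding decseq_Suc_iff q0_def by (intro allI suminf_le \<phi>_dec \<phi>_summable)
  have q0_step: "q0 j - q0 (Suc j) \<le> \<sigma> * q0 j" for j
  proof -
    have "q0 j - q0 (Suc j) = (\<Sum>k. \<phi> k j - \<phi> k (Suc j))"
      unfolding q0_def by (intro suminf_diff \<phi>_summable)
    also have "\<dots> \<le> (\<Sum>k. \<sigma> * \<phi> k j)"
      by (intro suminf_le \<phi>_step summable_diff summable_mult \<phi>_summable)
    finally show ?thesis by (simp add: q0_def suminf_mult \<phi>_summable)
  qed
  have w_pos: "w j > 0" for j using \<alpha> by (simp add: w_def)
  have block: "(\<Sum>j<J. w j * \<phi> k j) \<le> (1/2) ^ k * (2 * \<alpha> / (\<alpha> - 1))" for J k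
  proof -
    define a where "a = real (N k)"
    have a: "a \<ge> 1" using N1 by (simp add: a_def)
    have "w j * \<phi> k j \<le> (1/2) ^ k * (\<alpha> / (\<alpha> - 1)) * (a / (a + real j)\<^sup>2)" for j
    proof -
      have "real j + \<alpha> \<le> \<alpha> * (a + real j)"
      proof -
        have "\<alpha> * 1 \<le> \<alpha> * a" "1 * real j \<le> \<alpha> * real j"
          using a \<alpha> by (intro mult_left_mono mult_right_mono; simp)+
        then show ?thesis by (simp add: distrib_left)
      qed
      then have "w j * \<phi> k j \<le> \<alpha> * (a + real j) / (\<alpha> - 1) * \<phi> k j"
        unfolding w_def using \<alpha> \<phi>_pos[of k j] by (intro mult_right_mono divide_right_mono) auto
      also have "\<dots> = (1/2) ^ k * (\<alpha> / (\<alpha> - 1)) * (a / (a + real j)\<^sup>2)"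
        using a by (simp add: \<phi>_def a_def[symmetric] power2_eq_square power3_eq_cube divide_simps)
      finally show ?thesis .
    qed
    then have "(\<Sum>j<J. w j * \<phi> k j) \<le> (1/2) ^ k * (\<alpha> / (\<alpha> - 1)) * (\<Sum>j<J. a / (a + real j)\<^sup>2)"
      unfolding sum_distrib_left by (intro sum_mono)
    also have "\<dots> \<le> (1/2) ^ k * (\<alpha> / (\<alpha> - 1)) * 2"
      using \<alpha> by (intro mult_left_mono sum_inverse_squares_from a) auto
    finally show ?thesis by (simp add: mult_ac)
  qed
  have "(\<Sum>j<J. w j * q0 j) \<le> (\<Sum>k. (1/2) ^ k * (2 * \<alpha> / (\<alpha> - 1)))" for J
  proof -
    have "(\<Sum>j<J. w j * q0 j) = (\<Sum>j<J. \<Sum>k. w j * \<phi> k j)"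
      by (simp add: q0_def suminf_mult \<phi>_summable)
    also have "\<dots> = (\<Sum>k. \<Sum>j<J. w j * \<phi> k j)"
      by (rule suminf_sum[symmetric]) (intro summable_mult \<phi>_summable)
    also have "\<dots> \<le> (\<Sum>k. (1/2) ^ k * (2 * \<alpha> / (\<alpha> - 1)))"
      by (intro suminf_le block summable_sum summable_mult summable_mult2 \<phi>_summable geom)
    finally show ?thesis .
  qed
  then have w_summable: "summable (\<lambda>j. w j * q0 j)"
    using w_pos q0_pos by (intro summableI_nonneg_bounded) (auto simp: less_imp_le)
  define c where "c = R / (\<Sum>j. w j * q0 j)"
  have S_pos: "(\<Sum>j. w j * q0 j) > 0"
    by (rule suminf_pos[OF w_summable]) (simp add: w_pos q0_pos)
  then have c: "c > 0" using R by (simp add: c_def)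
  define q where "q j = c * q0 j" for j
  show thesis
  proof (rule that[of q])
    have "(\<lambda>j. c * (w j * q0 j)) sums (c * (\<Sum>j. w j * q0 j))"
      by (intro sums_mult summable_sums w_summable)
    also have "c * (\<Sum>j. w j * q0 j) = R" using S_pos by (simp add: c_def)
    finally have "(\<lambda>j. w j * q j) sums R" by (simp add: q_def mult.left_commute)
    then show "impulses \<alpha> R q"
      using q0_dec q0_pos c \<alpha>
      by unfold_locales (auto simp: q_def w_def decseq_Suc_iff)
    show "q n - q (Suc n) \<le> \<sigma> * q n" for n
      using mult_left_mono[OF q0_step[of n], of c] c by (simp add: q_def algebra_simps)
    fix C :: real
    \<comment> \<open>\<open>G\<close> contributes \<open>8\<^sup>k\<close> and the square of the profile costs \<open>4\<^sup>k\<close>, which leaves \<open>2\<^sup>k\<close>.\<close>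
    obtain k where k: "C / (c / 27)\<^sup>2 < 2 ^ k"
      using real_arch_pow[of 2 "C / (c / 27)\<^sup>2"] by auto
    define a where "a = real (N k)"
    have a: "a \<ge> 1" using N1 by (simp add: a_def)
    have "(1/2) ^ k / (27 * a\<^sup>2) = \<phi> k (2 * N k)"
      using a by (simp add: \<phi>_def a_def[symmetric] power2_eq_square power3_eq_cube field_simps)
    also have "\<phi> k (2 * N k) \<le> q0 (2 * N k)"
      unfolding q0_def
      using sum_le_suminf[OF \<phi>_summable, of "{k}" "2 * N k"] \<phi>_pos by (auto simp: less_imp_le)
    finally have "c * ((1/2) ^ k / (27 * a\<^sup>2)) \<le> q (2 * N k)"
      unfolding q_def using c by (intro mult_left_mono) auto
    then have "a\<^sup>2 * (c * ((1/2) ^ k / (27 * a\<^sup>2))) \<le> a\<^sup>2 * q (2 * N k)"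
      by (rule mult_left_mono) simp
    then have *: "c / 27 * (1/2) ^ k \<le> a\<^sup>2 * q (2 * N k)"
      using a by simp
    have "C \<le> (c / 27)\<^sup>2 * 2 ^ k"
      using k c by (simp add: field_simps)
    also have "\<dots> = 8 ^ k * (c / 27 * (1/2) ^ k)\<^sup>2"
    proof -
      have "(8 :: real) ^ k * ((1/2) ^ k)\<^sup>2 = (8 * (1/2)\<^sup>2) ^ k"
        by (simp only: power_mult_distrib power_mult[symmetric] mult.commute)
      also have "8 * (1/2)\<^sup>2 = (2 :: real)" by (simp add: power2_eq_square)
      finally have "(c / 27)\<^sup>2 * 2 ^ k = (c / 27)\<^sup>2 * (8 ^ k * ((1/2) ^ k)\<^sup>2)"
        by simp
      then show ?thesis by (simp only: power_mult_distrib mult.left_commute)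
    qed
    also have "\<dots> \<le> G (N k) * (a\<^sup>2 * q (2 * N k))\<^sup>2"
    proof (rule mult_mono[OF _ power_mono[OF *]])
      show "(0 :: real) \<le> G (N k)"
        using N(3)[of k] by (rule order.trans[rotated]) simp
    qed (use c N(3) in auto)
    finally show "\<exists>n\<ge>1. C \<le> G n * ((real n)\<^sup>2 * q (2 * n))\<^sup>2"
      using N(1)[of k] by (auto simp: a_def)
  qed
qed

section \<open>Monotone Lipschitz interpolation and its potential\<close>

text \<open>
  McShane's extension, with one-sided hinges in place of cones: the infimum of the functions
  \<open>x \<mapsto> v\<^sub>n + L max(0, x - y\<^sub>n)\<close> inherits both monotonicity and the Lipschitz constant from
  them, and the two monotonicity assumptions on \<open>v\<close> and \<open>L y - v\<close> say that no hinge lies below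
  a data point. The infimum vanishes at \<open>0\<close>, so reflecting it gives an odd function.
\<close>
lemma monotone_lipschitz_interpolation:
  fixes y v :: "nat \<Rightarrow> real"
  assumes L: "L \<ge> 0" and y_dec: "decseq y" and y_lim: "y \<longlonglongrightarrow> 0"
    and v_dec: "decseq v" and v_lim: "v \<longlonglongrightarrow> 0" and v_pos: "\<And>n. v n > 0"
    and slope: "decseq (\<lambda>n. L * y n - v n)"
  obtains h where "\<And>x. h (- x) = - h x" and "mono h" and "L-lipschitz_on UNIV h"
    and "\<And>n. h (y n) = v n" and "\<And>x. x > 0 \<Longrightarrow> h x > 0"
proof -
  define u where "u n x = v n + L * max 0 (x - y n)" for n x
  define g where "g x = (INF n. u n x)" for x
  have u_nonneg: "0 \<le> u n x" for n x
    using v_pos[of n] L by (simp add: u_def less_imp_le add_nonneg_nonneg)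
  have bdd: "bdd_below (range (\<lambda>n. u n x))" for x
    using u_nonneg by (intro bdd_belowI[of _ 0]) auto
  have g_le: "g x \<le> u n x" for n x
    unfolding g_def by (rule cINF_lower[OF bdd]) simp
  have g_ge: "c \<le> g x" if "\<And>n. c \<le> u n x" for c x
    unfolding g_def by (rule cINF_greatest) (use that in auto)
  have y_nonneg: "y n \<ge> 0" for n
    by (rule decseq_ge[OF y_dec y_lim])
  have g_y: "g (y n) = v n" for n
  proof (rule order.antisym)
    show "g (y n) \<le> v n" using g_le[of "y n" n] by (simp add: u_def)
    have "v n \<le> u m (y n)" for m
    proof (cases "m \<le> n")
      case True
      then have "v n \<le> v m" by (rule decseqD[OF v_dec])
      then show ?thesis using L by (simp add: u_def add_increasing2)
    next
      case False
      then have "L * y m - v m \<le> L * y n - v n"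
        by (intro decseqD[OF slope]) auto
      moreover have "L * (y n - y m) \<le> L * max 0 (y n - y m)"
        using L by (intro mult_left_mono) auto
      ultimately show ?thesis by (simp add: u_def algebra_simps)
    qed
    then show "v n \<le> g (y n)" by (rule g_ge)
  qed
  have g_mono: "g x \<le> g x'" if "x \<le> x'" for x x'
  proof (rule g_ge)
    fix n
    have "L * max 0 (x - y n) \<le> L * max 0 (x' - y n)"
      using that by (intro mult_left_mono L) auto
    then show "g x \<le> u n x'"
      using g_le[of x n] by (simp add: u_def)
  qed
  have g_lip: "g x' \<le> g x + L * (x' - x)" if "x \<le> x'" for x x'
  proof -
    have "g x' - L * (x' - x) \<le> g x"
    proof (rule g_ge)
      fix n
      have "L * max 0 (x' - y n) \<le> L * (max 0 (x - y n) + (x' - x))"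
        using L that by (intro mult_left_mono) auto
      then show "g x' - L * (x' - x) \<le> u n x"
        using g_le[of x' n] by (simp add: u_def algebra_simps)
    qed
    then show ?thesis by simp
  qed
  have g0: "g 0 = 0"
  proof (rule order.antisym)
    have "g 0 \<le> v n" for n
      using g_le[of 0 n] y_nonneg[of n] by (simp add: u_def)
    then show "g 0 \<le> 0" using LIMSEQ_le_const[OF v_lim] by blast
    show "0 \<le> g 0" by (rule g_ge[OF u_nonneg])
  qed
  \<comment> \<open>The odd extension of the restriction of \<open>g\<close> to \<open>x \<ge> 0\<close>, written without case distinction.\<close>
  define h where "h x = g (max 0 x) - g (max 0 (- x))" for x
  have h_mono: "h x \<le> h x'" if "x \<le> x'" for x x'
  proof -
    have "g (max 0 x) \<le> g (max 0 x')" "g (max 0 (- x')) \<le> g (max 0 (- x))"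
      using that by (auto intro!: g_mono)
    then show ?thesis by (simp add: h_def)
  qed
  have h_lip: "h x' - h x \<le> L * (x' - x)" if "x \<le> x'" for x x'
  proof -
    have "g (max 0 x') \<le> g (max 0 x) + L * (max 0 x' - max 0 x)"
      "g (max 0 (- x)) \<le> g (max 0 (- x')) + L * (max 0 (- x) - max 0 (- x'))"
      using that by (auto intro!: g_lip)
    then have "h x' - h x \<le> L * (max 0 x' - max 0 x) + L * (max 0 (- x) - max 0 (- x'))"
      unfolding h_def by linarith
    also have "\<dots> = L * (x' - x)"
      by (simp add: max_def algebra_simps)
    finally show ?thesis .
  qed
  show thesis
  proof (rule that[of h])
    show "h (- x) = - h x" for x by (simp add: h_def)
    show "mono h" by (rule monoI) (rule h_mono)
    show "L-lipschitz_on UNIV h"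
    proof (rule lipschitz_onI)
      fix x x' :: real
      show "dist (h x) (h x') \<le> L * dist x x'"
        using h_mono[of x x'] h_mono[of x' x] h_lip[of x x'] h_lip[of x' x]
        by (cases "x \<le> x'") (auto simp: dist_real_def abs_if algebra_simps)
    qed (rule L)
    show h_y: "h (y n) = v n" for n
      using y_nonneg[of n] by (simp add: h_def g_y g0)
    show "h x > 0" if "x > 0" for x
    proof -
      have "\<forall>\<^sub>F n in sequentially. y n < x"
        using y_lim that by (rule order_tendstoD)
      then obtain n where "y n < x" by (auto dest: eventually_happens)
      then have "h (y n) \<le> h x" by (intro h_mono) simp
      then show ?thesis using v_pos[of n] by (simp add: h_y)
    qed
  qed
qed

lemma even_convex_potential:
  fixes h :: "real \<Rightarrow> real"
  assumes cont: "continuous_on UNIV h" and odd: "\<And>x. h (- x) = - h x" and mono: "mono h"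
    and pos: "\<And>x. x > 0 \<Longrightarrow> h x > 0"
  obtains F where "\<And>x. (F has_real_derivative h x) (at x)" and "\<And>x. F (- x) = F x"
    and "convex_on UNIV F" and "F 0 = 0" and "\<And>x. x \<noteq> 0 \<Longrightarrow> F x > 0"
    and "\<And>a x. F a + h a * (x - a) \<le> F x"
proof -
  have "\<exists>F0. \<forall>x::real. -\<infinity> < ereal x \<longrightarrow> ereal x < \<infinity> \<longrightarrow> (F0 has_vector_derivative h x) (at x)"
    using cont by (intro einterval_antiderivative) (auto simp: continuous_on_eq_continuous_at)
  then obtain F0 where F0: "\<And>x. (F0 has_real_derivative h x) (at x)"
    by (auto simp: has_real_derivative_iff_has_vector_derivative)
  define F where "F x = F0 x - F0 0" for x
  have der: "(F has_real_derivative h x) (at x)" for x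
    unfolding F_def using F0 by (auto intro!: derivative_eq_intros)
  have "\<forall>x. ((\<lambda>x. F (- x) - F x) has_real_derivative 0) (at x)"
    by (auto intro!: derivative_eq_intros DERIV_chain2[OF der] der simp: odd)
  then have "F (- x) - F x = F (- 0) - F 0" for x
    using DERIV_isconst_all[of "\<lambda>x. F (- x) - F x"] by blast
  then have even: "F (- x) = F x" for x by simp
  have conv: "convex_on UNIV F"
    by (rule convex_on_realI[where f' = h]) (auto simp: der monoD[OF mono])
  have tangent: "F a + h a * (x - a) \<le> F x" for a x
    using convex_on_imp_above_tangent[OF conv, of a x "h a"] der[of a] by simp
  have F_pos: "F x > 0" if "x > 0" for x
  proof -
    have "F 0 + h 0 * (x / 2 - 0) \<le> F (x / 2)" by (rule tangent)
    moreover have "h 0 = 0" using odd[of 0] by simp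
    moreover have "F (x / 2) + h (x / 2) * (x - x / 2) \<le> F x" by (rule tangent)
    moreover have "h (x / 2) * (x - x / 2) > 0" using that pos by simp
    ultimately show ?thesis by (simp add: F_def)
  qed
  show thesis
  proof (rule that[of F])
    show "F x > 0" if "x \<noteq> 0" for x
      using F_pos[of x] F_pos[of "- x"] that by (cases "x > 0") (auto simp: even)
  qed (use der even conv tangent in \<open>auto simp: F_def\<close>)
qed

section \<open>Minimizers, coercivity, and the passage to higher dimension\<close>

lemma coercive_on_linear_growth:
  fixes F :: "'a::real_normed_vector \<Rightarrow> real"
  assumes "c > 0" and "\<And>x. x \<in> S \<Longrightarrow> c * norm x - K \<le> F x"
  shows "coercive_on S F"
  unfolding coercive_on_def
proof (rule filterlim_at_top_mono)
  have "filterlim (\<lambda>x::'a. - K + c * norm x) at_top at_infinity"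
    by (intro filterlim_tendsto_add_at_top[OF tendsto_const]
        filterlim_tendsto_pos_mult_at_top[OF tendsto_const \<open>c > 0\<close>] filterlim_norm_at_top)
  then have "filterlim (\<lambda>x::'a. c * norm x - K) at_top at_infinity"
    by simp
  then show "filterlim (\<lambda>x::'a. c * norm x - K) at_top (inf at_infinity (principal S))"
    by (rule filterlim_mono[OF _ order.refl inf_le1])
  show "\<forall>\<^sub>F x in inf at_infinity (principal S). c * norm x - K \<le> F x"
    using assms(2) by (auto simp: eventually_inf_principal)
qed

lemma unique_minimizer_on_zero:
  fixes F :: "'a::zero \<Rightarrow> real"
  assumes "0 \<in> S" "F 0 = 0" "\<And>x. x \<in> S \<Longrightarrow> x \<noteq> 0 \<Longrightarrow> F x > 0"
  shows "unique_minimizer_on S F 0" and "min_value_on S F = 0"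
proof -
  have ge: "F x \<ge> 0" if "x \<in> S" for x
    using assms that by (cases "x = 0") (auto simp: less_imp_le)
  then show "unique_minimizer_on S F 0"
    using assms unfolding unique_minimizer_on_def is_arg_min_def by (metis not_less)
  show "min_value_on S F = 0"
    unfolding min_value_on_def by (rule Least_equality) (use assms ge in force)+
qed

text \<open>
  For a unit vector \<open>e\<close>, the vector \<open>x - (x \<bullet> e) e\<close> is the component of \<open>x\<close> orthogonal to the axis.
  The curvature across the axis is chosen as \<open>L\<close>, the largest value that keeps the gradient
  \<open>L\<close>-Lipschitz.
\<close>
definition cylinder :: "real \<Rightarrow> 'a::real_inner \<Rightarrow> (real \<Rightarrow> real) \<Rightarrow> 'a \<Rightarrow> real" where
  "cylinder L e F x = F (inner x e) + L / 2 * (norm (x - inner x e *\<^sub>R e))\<^sup>2"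

definition cylinder_grad :: "real \<Rightarrow> 'a::real_inner \<Rightarrow> (real \<Rightarrow> real) \<Rightarrow> 'a \<Rightarrow> 'a" where
  "cylinder_grad L e h x = h (inner x e) *\<^sub>R e + L *\<^sub>R (x - inner x e *\<^sub>R e)"

context
  fixes e :: "'a::real_inner" and L :: real
  assumes e: "norm e = 1" and L: "L > 0"
begin

lemma inner_e: "inner e e = 1"
  using e by (simp add: norm_eq_1)

lemma perp_inner: "inner (x - inner x e *\<^sub>R e) e = 0"
  by (simp add: inner_diff_left inner_e)

text \<open>
  Pythagoras, with independent coefficients so that it covers both points and differences of
  gradients.
\<close>
lemma norm_split: "(norm (a *\<^sub>R e + b *\<^sub>R (x - inner x e *\<^sub>R e)))\<^sup>2
    = a\<^sup>2 + b\<^sup>2 * (norm (x - inner x e *\<^sub>R e))\<^sup>2"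
proof -
  define u where "u = x - inner x e *\<^sub>R e"
  have "inner u e = 0" "inner e u = 0" using perp_inner[of x] by (simp_all add: u_def inner_commute)
  then show ?thesis
    unfolding u_def[symmetric] power2_norm_eq_inner
    by (simp add: inner_add_left inner_add_right inner_e power2_eq_square)
qed

lemma norm_decomp: "(norm x)\<^sup>2 = (inner x e)\<^sup>2 + (norm (x - inner x e *\<^sub>R e))\<^sup>2"
  using norm_split[of "inner x e" 1 x] by simp

lemma convex_on_cylinder:
  assumes "convex_on UNIV F"
  shows "convex_on UNIV (cylinder L e F)"
proof (rule convex_onI)
  fix t :: real and x y :: 'a
  assume t: "0 < t" "t < 1"
  define P where "P x = x - inner x e *\<^sub>R e" for x
  define z where "z = (1 - t) *\<^sub>R x + t *\<^sub>R y"
  have Pz: "P z = (1 - t) *\<^sub>R P x + t *\<^sub>R P y"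
    by (simp add: P_def z_def algebra_simps inner_add_left)
  have "(norm (P z))\<^sup>2 = (1 - t) * (norm (P x))\<^sup>2 + t * (norm (P y))\<^sup>2 - (1 - t) * t * (norm (P x - P y))\<^sup>2"
    unfolding Pz power2_norm_eq_inner
    by (simp add: inner_add_left inner_add_right inner_diff_left inner_diff_right inner_commute[of "P y" "P x"] algebra_simps)
  also have "\<dots> \<le> (1 - t) * (norm (P x))\<^sup>2 + t * (norm (P y))\<^sup>2"
    using t by simp
  finally have "L / 2 * (norm (P z))\<^sup>2 \<le> L / 2 * ((1 - t) * (norm (P x))\<^sup>2 + t * (norm (P y))\<^sup>2)"
    using L by (intro mult_left_mono) auto
  moreover have "F (inner z e) \<le> (1 - t) * F (inner x e) + t * F (inner y e)"
    using convex_onD[OF assms, of t "inner x e" "inner y e"] t by (simp add: z_def inner_add_left)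
  ultimately have "F (inner z e) + L / 2 * (norm (P z))\<^sup>2
      \<le> (1 - t) * F (inner x e) + t * F (inner y e)
        + L / 2 * ((1 - t) * (norm (P x))\<^sup>2 + t * (norm (P y))\<^sup>2)"
    by (rule add_mono[rotated])
  also have "\<dots> = (1 - t) * (F (inner x e) + L / 2 * (norm (P x))\<^sup>2)
      + t * (F (inner y e) + L / 2 * (norm (P y))\<^sup>2)"
    by (simp only: distrib_left mult.left_commute add_ac)
  finally show "cylinder L e F ((1 - t) *\<^sub>R x + t *\<^sub>R y) \<le> (1 - t) * cylinder L e F x + t * cylinder L e F y"
    unfolding cylinder_def P_def[symmetric] z_def[symmetric] .
qed simp

lemma has_derivative_cylinder:
  assumes "\<And>t. (F has_real_derivative h t) (at t)"
  shows "(cylinder L e F has_derivative (\<lambda>k. inner k (cylinder_grad L e h x))) (at x within S)"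
proof -
  have F: "((\<lambda>x. F (inner x e)) has_derivative (\<lambda>k. inner k e * h (inner x e))) (at x within S)"
    by (rule DERIV_compose_FDERIV[OF assms]) (auto intro!: derivative_eq_intros)
  have Q: "((\<lambda>x. inner x x - inner x e * inner x e) has_derivative
      (\<lambda>k. 2 * inner k (x - inner x e *\<^sub>R e))) (at x within S)"
    by (auto intro!: derivative_eq_intros
        simp: fun_eq_iff inner_diff_right inner_commute algebra_simps)
  have "cylinder L e F = (\<lambda>x. F (inner x e) + L / 2 * (inner x x - inner x e * inner x e))"
  proof
    show "cylinder L e F x = F (inner x e) + L / 2 * (inner x x - inner x e * inner x e)" for x
      using norm_decomp[of x]
      by (simp add: cylinder_def power2_eq_square[of "inner x e"] power2_norm_eq_inner[of x])
  qed
  moreover have "(\<lambda>k. inner k (cylinder_grad L e h x))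
      = (\<lambda>k. inner k e * h (inner x e) + L / 2 * (2 * inner k (x - inner x e *\<^sub>R e)))"
    by (simp add: fun_eq_iff cylinder_grad_def inner_add_right)
  ultimately show ?thesis
    using has_derivative_add[OF F has_derivative_mult_right[OF Q, of "L / 2"]] by simp
qed

lemma lipschitz_on_cylinder_grad:
  assumes "L-lipschitz_on UNIV h"
  shows "L-lipschitz_on S (cylinder_grad L e h)"
proof (rule lipschitz_onI)
  fix x y :: 'a
  have "cylinder_grad L e h x - cylinder_grad L e h y
      = (h (inner x e) - h (inner y e)) *\<^sub>R e + L *\<^sub>R ((x - y) - inner (x - y) e *\<^sub>R e)"
    by (simp add: cylinder_grad_def algebra_simps inner_diff_left)
  then have "(norm (cylinder_grad L e h x - cylinder_grad L e h y))\<^sup>2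
      = (h (inner x e) - h (inner y e))\<^sup>2 + L\<^sup>2 * (norm ((x - y) - inner (x - y) e *\<^sub>R e))\<^sup>2"
    by (simp only: norm_split)
  also have "(h (inner x e) - h (inner y e))\<^sup>2 \<le> (L * (inner (x - y) e))\<^sup>2"
    using lipschitz_onD[OF assms, of "inner x e" "inner y e"] L
    by (subst abs_le_square_iff[symmetric]) (simp add: dist_real_def abs_mult inner_diff_left)
  also have "(L * (inner (x - y) e))\<^sup>2 + L\<^sup>2 * (norm ((x - y) - inner (x - y) e *\<^sub>R e))\<^sup>2 = (L * norm (x - y))\<^sup>2"
    unfolding power_mult_distrib by (subst norm_decomp[of "x - y"]) (simp add: algebra_simps)
  finally show "dist (cylinder_grad L e h x) (cylinder_grad L e h y) \<le> L * dist x y"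
    using L by (auto simp: dist_norm intro: power2_le_imp_le)
qed (use L in simp)

text \<open>
  Across the axis the quadratic term dominates a linear one by \<open>u \<le> (u\<^sup>2 + 1) / 2\<close>.
\<close>
lemma cylinder_linear_growth:
  assumes "c > 0" and "\<And>t. c * \<bar>t\<bar> - K \<le> F t"
  shows "min c L * norm x - (K + L / 2) \<le> cylinder L e F x"
proof -
  define t u where "t = inner x e" and "u = norm (x - inner x e *\<^sub>R e)"
  have "norm x \<le> norm (t *\<^sub>R e) + u"
    unfolding t_def u_def
    using norm_triangle_ineq[of "inner x e *\<^sub>R e" "x - inner x e *\<^sub>R e"] by simp
  then have "norm x \<le> \<bar>t\<bar> + u" using e by simp
  then have "min c L * norm x \<le> min c L * (\<bar>t\<bar> + u)"
    using assms L by (intro mult_left_mono) auto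
  also have "\<dots> \<le> c * \<bar>t\<bar> + L * u"
    by (auto simp: distrib_left u_def intro!: add_mono mult_right_mono)
  finally have "min c L * norm x \<le> c * \<bar>t\<bar> + L * u" .
  moreover have "L * u \<le> L / 2 * u\<^sup>2 + L / 2"
  proof -
    have "0 \<le> L / 2 * (u - 1)\<^sup>2" using L by simp
    then show ?thesis by (simp add: power2_eq_square algebra_simps)
  qed
  moreover have "cylinder L e F x = F t + L / 2 * u\<^sup>2"
    by (simp add: cylinder_def t_def u_def)
  ultimately show ?thesis
    using assms(2)[of t] by linarith
qed

lemma cylinder_pos:
  assumes "F 0 = 0" and "\<And>t. t \<noteq> 0 \<Longrightarrow> F t > 0" and "x \<noteq> 0"
  shows "cylinder L e F x > 0"
proof (cases "inner x e = 0")
  case True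
  then show ?thesis using assms L by (simp add: cylinder_def)
next
  case False
  then show ?thesis using assms L by (auto simp: cylinder_def intro!: add_pos_nonneg)
qed

lemma cylinder_on_axis: "cylinder L e F (r *\<^sub>R e) = F r"
  by (simp add: cylinder_def inner_e)

lemma cd_orbit_cylinder_grad:
  "cd_orbit \<alpha> s (cylinder_grad L e h) (a *\<^sub>R e) (b *\<^sub>R e) n = cd_orbit \<alpha> s h a b n *\<^sub>R e"
proof (induction n rule: induct_nat_012)
  case (ge2 n)
  have grad: "cylinder_grad L e h (r *\<^sub>R e) = h r *\<^sub>R e" for r
    by (simp add: cylinder_grad_def inner_e)
  have comb: "p *\<^sub>R e + \<beta> *\<^sub>R (p *\<^sub>R e - r *\<^sub>R e) = (p + \<beta> * (p - r)) *\<^sub>R e" for p r \<beta>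
    by (simp add: algebra_simps)
  show ?case
    by (simp only: cd_orbit.simps ge2 Let_def comb grad) (simp add: algebra_simps)
qed simp_all

end

lemma exists_unit_axis:
  assumes "d \<ge> 1"
  obtains e where "e \<in> Rspace d" and "norm e = 1"
proof -
  define e where "e = Abs_rseq (\<lambda>i. if i = 0 then 1 else 0)"
  have coord_e: "coord e = (\<lambda>i. if i = 0 then 1 else 0)"
    unfolding e_def by (rule Abs_rseq_inverse) auto
  have "e \<in> Rspace d" using assms by (simp add: Rspace_def coord_e)
  moreover have "inner e e = 1" by (simp add: inner_rseq_def coord_e)
  ultimately show thesis using that by (simp add: norm_eq_1)
qed

section \<open>The lower bound\<close>

theorem theorem1:
  fixes \<alpha> L s R :: real and G :: "nat \<Rightarrow> real"
  assumes "\<alpha> > 3" and "L > 0" and "0 < s" and "s < inverse L" and "R > 0"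
    and "\<And>n. n \<ge> 1 \<Longrightarrow> G n > 0"
    and "mono_on {1..} G"
    and "filterlim G at_top sequentially"
  shows "\<exists>F :: real \<Rightarrow> real.
    (\<forall>x. F (- x) = F x) \<and>
    convex_on UNIV F \<and>
    coercive_on UNIV F \<and>
    F differentiable_on UNIV \<and>
    L-lipschitz_on UNIV (deriv F) \<and>
    unique_minimizer_on UNIV F 0 \<and>
    F 0 = 0 \<and>
    min_value_on UNIV F = 0 \<and>
    (SUP n\<in>{1..}. ereal ((real n)\<^sup>2 * G n *
       (F (cd_orbit \<alpha> s (deriv F) R R n) - min_value_on UNIV F))) = \<infinity> \<and>
    (\<forall>d\<ge>1. \<exists>(Fh :: rseq \<Rightarrow> real) gradFh z x1.
       convex_on (Rspace d) Fh \<and>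
       coercive_on (Rspace d) Fh \<and>
       has_gradient_on Fh gradFh (Rspace d) \<and>
       L-lipschitz_on (Rspace d) gradFh \<and>
       unique_minimizer_on (Rspace d) Fh z \<and>
       x1 \<in> Rspace d \<and>
       norm (x1 - z) = R \<and>
       (\<forall>n\<ge>1. Fh (cd_orbit \<alpha> s gradFh x1 x1 n) - min_value_on (Rspace d) Fh =
          F (cd_orbit \<alpha> s (deriv F) R R n) - min_value_on UNIV F))"
proof -
  have \<alpha>: "\<alpha> > 1" and sL: "s * L > 0" using assms by auto
  obtain q where q: "impulses \<alpha> R q"
    and q_step: "\<And>n. q n - q (Suc n) \<le> s * L * q n"
    and q_slow: "\<And>C. \<exists>n\<ge>1. C \<le> G n * ((real n)\<^sup>2 * q (2 * n))\<^sup>2"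
    using exists_slow_impulses[OF \<alpha> sL \<open>R > 0\<close> assms(8)] by blast
  interpret impulses \<alpha> R q by (rule q)
  let ?x = "position \<alpha> R q" and ?y = "extrapolated \<alpha> R q"
  \<comment> \<open>The chords of the data \<open>(y\<^sub>n, q\<^sub>n / s)\<close> have slope at most \<open>L\<close>.\<close>
  have slope: "decseq (\<lambda>n. L * ?y n - q n / s)"
    unfolding decseq_Suc_iff
  proof
    fix n
    have "(q n - q (Suc n)) / s \<le> s * L * q n / s"
      using q_step[of n] assms by (intro divide_right_mono) auto
    also have "\<dots> = L * q n" using assms by simp
    also have "\<dots> \<le> L * (?y n - ?y (Suc n))"
      using extrapolated_step[of n] assms by (intro mult_left_mono) auto
    finally show "L * ?y (Suc n) - q (Suc n) / s \<le> L * ?y n - q n / s"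
      by (simp add: right_diff_distrib diff_divide_distrib)
  qed
  obtain h where h_odd: "\<And>x. h (- x) = - h x" and h_mono: "mono h"
    and h_lip: "L-lipschitz_on UNIV h" and h_y: "\<And>n. h (?y n) = q n / s"
    and h_pos: "\<And>x. x > 0 \<Longrightarrow> h x > 0"
  proof (rule monotone_lipschitz_interpolation[of L ?y "\<lambda>n. q n / s"])
    show "decseq (\<lambda>n. q n / s)"
      using q_dec assms by (auto simp: decseq_Suc_iff divide_right_mono)
    show "(\<lambda>n. q n / s) \<longlonglongrightarrow> 0"
      using tendsto_divide[OF q_tendsto_0 tendsto_const[of s]] assms by simp
  qed (use assms extrapolated_decseq extrapolated_tendsto_0 q_pos slope in auto)
  obtain F where F_der: "\<And>x. (F has_real_derivative h x) (at x)" and F_even: "\<And>x. F (- x) = F x"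
    and F_conv: "convex_on UNIV F" and F0: "F 0 = 0" and F_pos: "\<And>x. x \<noteq> 0 \<Longrightarrow> F x > 0"
    and F_tangent: "\<And>a x. F a + h a * (x - a) \<le> F x"
    using even_convex_potential[OF lipschitz_on_continuous_on[OF h_lip] h_odd h_mono h_pos] by blast
  have deriv_F: "deriv F = h"
    using F_der by (auto intro: DERIV_imp_deriv)
  have orbit: "cd_orbit \<alpha> s h R R n = ?x n" for n
    by (rule cd_orbit_eq_position) (use h_y assms in simp)
  have F_nonneg: "F x \<ge> 0" for x
    using F_pos[of x] F0 by (cases "x = 0") auto
  have growth: "h 1 * \<bar>t\<bar> - h 1 \<le> F t" for t
  proof -
    have "h 1 * (\<bar>t\<bar> - 1) \<le> F \<bar>t\<bar>"
      using F_tangent[of 1 "\<bar>t\<bar>"] F_nonneg[of 1] by linarith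
    moreover have "F \<bar>t\<bar> = F t" by (simp add: abs_if F_even)
    ultimately show ?thesis by (simp add: algebra_simps)
  qed
  have h1: "h 1 > 0" by (simp add: h_pos)
  have minF: "unique_minimizer_on UNIV F 0" "min_value_on UNIV F = 0"
    using unique_minimizer_on_zero[of UNIV F] F0 F_pos by auto
  \<comment> \<open>The tangent of \<open>F\<close> at \<open>x\<^bsub>2n\<^esub>\<close> bounds \<open>F(x\<^sub>n)\<close> below by slope times displacement.\<close>
  have lower: "((real n)\<^sup>2 * (q (2 * n))\<^sup>2) / (s * (\<alpha> + 1)) \<le> F (?x n)" for n
  proof -
    have "?y (2 * n) \<le> ?x (2 * n)"
      using extrapolated_le_position[of "2 * n"] position_decseq[THEN decseqD, of "2 * n" "Suc (2 * n)"]
      by simp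
    then have hx: "q (2 * n) / s \<le> h (?x (2 * n))"
      using monoD[OF h_mono] h_y[of "2 * n"] by metis
    have "((real n)\<^sup>2 * (q (2 * n))\<^sup>2) / (s * (\<alpha> + 1))
        = q (2 * n) / s * ((real n)\<^sup>2 * q (2 * n) / (\<alpha> + 1))"
      by (simp add: power2_eq_square)
    also have "\<dots> \<le> h (?x (2 * n)) * (?x n - ?x (2 * n))"
      using hx position_drop[of n] q_pos[of "2 * n"] assms
      by (intro mult_mono) (auto intro: order.trans[OF _ hx] simp: less_imp_le)
    also have "\<dots> \<le> F (?x n)"
      using F_tangent[of "?x (2 * n)" "?x n"] F_nonneg[of "?x (2 * n)"] by linarith
    finally show ?thesis .
  qed
  have sup: "(SUP n\<in>{1..}. ereal ((real n)\<^sup>2 * G n * F (?x n))) = \<infinity>"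
  proof (rule SUP_PInfty)
    fix m :: nat
    obtain n where n: "n \<ge> 1" "real m * (s * (\<alpha> + 1)) \<le> G n * ((real n)\<^sup>2 * q (2 * n))\<^sup>2"
      using q_slow by blast
    have "real m \<le> (real n)\<^sup>2 * G n * (((real n)\<^sup>2 * (q (2 * n))\<^sup>2) / (s * (\<alpha> + 1)))"
      using n(2) assms by (simp add: pos_le_divide_eq power_mult_distrib power2_eq_square mult_ac)
    also have "\<dots> \<le> (real n)\<^sup>2 * G n * F (?x n)"
      using assms(6)[OF n(1)] by (intro mult_left_mono lower) auto
    finally show "\<exists>i\<in>{1..}. ereal (real m) \<le> ereal ((real i)\<^sup>2 * G i * F (?x i))"
      using n(1) by auto
  qed
  have lift: "\<exists>(Fh :: rseq \<Rightarrow> real) gradFh z x1.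
       convex_on (Rspace d) Fh \<and> coercive_on (Rspace d) Fh \<and>
       has_gradient_on Fh gradFh (Rspace d) \<and> L-lipschitz_on (Rspace d) gradFh \<and>
       unique_minimizer_on (Rspace d) Fh z \<and> x1 \<in> Rspace d \<and> norm (x1 - z) = R \<and>
       (\<forall>n\<ge>1. Fh (cd_orbit \<alpha> s gradFh x1 x1 n) - min_value_on (Rspace d) Fh
          = F (cd_orbit \<alpha> s h R R n))"
    if "d \<ge> 1" for d
  proof -
    obtain e where e: "e \<in> Rspace d" "norm e = 1" using exists_unit_axis[OF \<open>d \<ge> 1\<close>] by blast
    let ?Fh = "cylinder L e F" and ?gr = "cylinder_grad L e h"
    note S = subspace_Rspace[of d]
    have zero: "?Fh 0 = 0" using F0 by (simp add: cylinder_def)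
    note Fh_pos = cylinder_pos[where F = F, OF e(2) \<open>L > 0\<close> F0 F_pos]
    note min = unique_minimizer_on_zero[of "Rspace d" ?Fh, OF subspace_0[OF S] zero Fh_pos]
    have "convex_on (Rspace d) ?Fh"
      by (rule convex_on_subset[OF convex_on_cylinder[OF e(2) \<open>L > 0\<close> F_conv]])
        (auto intro: subspace_imp_convex S)
    moreover have "coercive_on (Rspace d) ?Fh"
      by (rule coercive_on_linear_growth[OF _ cylinder_linear_growth[OF e(2) \<open>L > 0\<close> h1 growth]])
        (use h1 \<open>L > 0\<close> in simp)
    moreover have "has_gradient_on ?Fh ?gr (Rspace d)"
      unfolding has_gradient_on_def
      using has_derivative_cylinder[OF e(2) \<open>L > 0\<close> F_der] S e(1)
      by (auto simp: cylinder_grad_def intro!: subspace_add subspace_scale subspace_diff)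
    moreover have "L-lipschitz_on (Rspace d) ?gr"
      by (rule lipschitz_on_cylinder_grad[OF e(2) \<open>L > 0\<close> h_lip])
    moreover have "unique_minimizer_on (Rspace d) ?Fh 0" by (rule min(1))
    moreover have "R *\<^sub>R e \<in> Rspace d" using S e(1) by (rule subspace_scale)
    moreover have "norm (R *\<^sub>R e - 0) = R" using e(2) \<open>R > 0\<close> by simp
    moreover have "?Fh (cd_orbit \<alpha> s ?gr (R *\<^sub>R e) (R *\<^sub>R e) n) - min_value_on (Rspace d) ?Fh
        = F (cd_orbit \<alpha> s h R R n)" for n
      by (simp add: min(2) cd_orbit_cylinder_grad[OF e(2) \<open>L > 0\<close>] cylinder_on_axis[OF e(2) \<open>L > 0\<close>])
    ultimately show ?thesis by blast
  qed
  show ?thesis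
  proof (intro exI[of _ F] conjI)
    show "coercive_on UNIV F"
      by (rule coercive_on_linear_growth[OF h1, of _ "h 1"]) (use growth in simp)
    show "F differentiable_on UNIV"
      using F_der
      by (auto simp: differentiable_on_def real_differentiable_def intro: has_field_derivative_at_within)
  qed (use F_even F_conv F0 h_lip minF sup lift in \<open>simp_all add: deriv_F orbit\<close>)
qed

end
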